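(* Let $m$ be an even positive integer, let $Y$ be a skew-symmetric matrix of size $m$, and let $M=(a_ib_j)_{1\le i,j\le m}$ be a rank-$1$ matrix of the same size. Then $$\det(Y+M)=\operatorname{Pf}(Y)\Bigg(\operatorname{Pf}(Y)+\sum_{1\le i<j\le m}(-1)^{i+j-1}(a_ib_j-a_jb_i)\operatorname{Pf}(Y(i,j))\Bigg),$$ where $Y(i,j)$ arises from $Y$ by deleting the $i$-th and $j$-th rows and the $i$-th and $j$-th columns.
   Context: Entries lie in a commutative ring with unit; skew-symmetric means $Y^t=-Y$ with zero diagonal. "Rank-$1$ matrix" simply means a matrix of the form $(a_ib_j)$ for elements $a_1,\dots,a_m,b_1,\dots,b_m$. For a skew-symmetric matrix $Y$ of even size $m$, the Pfaffian is $\operatorname{Pf}(Y)=\sum_{\mu}\operatorname{sgn}\mu\prod_{\{i,j\}\in\mu,\ i<j}Y_{i,j}$, the sum being over all perfect matchings $\mu$ of $\{1,\dots,m\}$, where $\operatorname{sgn}\mu=(-1)^{\mathrm{cr}(\mu)}$ and $\mathrm{cr}(\mu)$ is the number of quadruples $i<j<k<l$ such that $\{i,k\}$ and $\{j,l\}$ are pairs in $\mu$. The Pfaffian of the empty ($0\times 0$) matrix is $1$. *)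

theory Defs
  imports
    "HOL-Library.Disjoint_Sets"
    "Jordan_Normal_Form.Determinant"
    "Jordan_Normal_Form.DL_Submatrix"
begin

text \<open>Rows and columns are numbered from \<open>0\<close>, so the index set is \<open>{..<m}\<close> instead of \<open>{1..m}\<close>.\<close>

text \<open>The zero diagonal is not implied by the first conjunct in characteristic \<open>2\<close>.\<close>

definition skew_symmetric_mat :: "'a::comm_ring_1 mat \<Rightarrow> bool" where
  "skew_symmetric_mat Y \<longleftrightarrow> transpose_mat Y = - Y \<and> (\<forall>i<dim_row Y. Y $$ (i, i) = 0)"

definition perfect_matchings :: "nat set \<Rightarrow> nat set set set" where
  "perfect_matchings V = {\<mu>. partition_on V \<mu> \<and> (\<forall>e\<in>\<mu>. card e = 2)}"

definition crossings :: "nat set set \<Rightarrow> (nat \<times> nat \<times> nat \<times> nat) set" where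
  "crossings \<mu> = {(i, j, k, l). i < j \<and> j < k \<and> k < l \<and> {i, k} \<in> \<mu> \<and> {j, l} \<in> \<mu>}"

text \<open>Meaningful for skew-symmetric matrices. For odd size there are no perfect matchings, and
  the value is \<open>0\<close>.\<close>

definition pfaffian :: "'a::comm_ring_1 mat \<Rightarrow> 'a" where
  "pfaffian Y = (\<Sum>\<mu>\<in>perfect_matchings {..<dim_row Y}.
     (-1) ^ card (crossings \<mu>) * (\<Prod>(i, j)\<in>{(i, j). i < j \<and> {i, j} \<in> \<mu>}. Y $$ (i, j)))"

definition delete_two :: "'a mat \<Rightarrow> nat \<Rightarrow> nat \<Rightarrow> 'a mat" where
  "delete_two Y i j = submatrix Y (- {i, j}) (- {i, j})"

definition rank1_mat :: "nat \<Rightarrow> 'a::comm_ring_1 vec \<Rightarrow> 'a vec \<Rightarrow> 'a mat" where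
  "rank1_mat m a b = mat m m (\<lambda>(i, j). a $ i * b $ j)"

end

theory Submission
  imports Defs
begin

text \<open>Border \<open>Y\<close> by a row \<open>(1, -b)\<close> on top and a column \<open>(1, a)\<close> on the left. Row reduction shows that the
bordered matrix has determinant \<open>det (Y + M)\<close> (lemma \<open>det_add_rank1\<close>). The bordered matrix is also a
submatrix of a skew-symmetric matrix \<open>B\<close> of size \<open>m + 2\<close> that has \<open>Y\<close> as a principal block and two
further indices \<open>p\<close>, \<open>q\<close>: its rows are \<open>p\<close> and those of \<open>Y\<close>, its columns are \<open>q\<close> and those of \<open>Y\<close>.
Such almost principal minors of an alternating matrix factor into Pfaffians. For an index list \<open>xs\<close>,
the minor with rows \<open>p, xs\<close> and columns \<open>q, xs\<close> equals \<open>pf xs * pf (p # q # xs)\<close> if \<open>xs\<close> has even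
length, and \<open>pf (p # xs) * pf (q # xs)\<close> if it has odd length (lemma \<open>bordered_minor\<close>). With \<open>xs\<close>
running through the indices of \<open>Y\<close>, the first factor is \<open>Pf(Y)\<close>, and expanding \<open>pf (p # q # xs)\<close>
along its first two rows gives the second factor of the assertion.

The factorization of bordered minors is proved by induction on the length of \<open>xs\<close>, over an arbitrary
commutative ring: expanding such a minor along its border yields principal minors and bordered minors
over shorter lists. The theorem of Cayley that \<open>det Y\<close> is the square of \<open>Pf(Y)\<close> is not an input but
comes out along the way, from the case \<open>p = q\<close>. No division and no passage to generic matrices occurs.

Pfaffians are handled through their first-row expansion on lists of indices (\<open>pf_list\<close>), where
antisymmetry under permutations of the list accounts for the signs. That this agrees with the
signed sum over perfect matchings (\<open>pf_list_eq_matching_sum\<close>) comes from sorting matchings by the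
partner of the smallest vertex and counting crossings with that edge modulo \<open>2\<close>.\<close>

section \<open>Deleting entries of a list\<close>

definition del_nth :: "nat \<Rightarrow> 'i list \<Rightarrow> 'i list" where
  "del_nth k xs = take k xs @ drop (Suc k) xs"

lemma length_del_nth [simp]: "k < length xs \<Longrightarrow> length (del_nth k xs) = length xs - 1"
  by (simp add: del_nth_def)

lemma del_nth_append [simp]: "del_nth (length us) (us @ x # vs) = us @ vs"
  by (simp add: del_nth_def)

lemma nth_del_nth:
  assumes "k < length xs" "i < length xs - 1"
  shows "del_nth k xs ! i = xs ! insert_index k i"
  using assms by (auto simp: del_nth_def nth_append insert_index_def)

lemma del_nth_del_nth:
  assumes "l < k" "k < length xs"
  shows "del_nth l (del_nth k xs) = del_nth (k - 1) (del_nth l xs)"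
proof (rule nth_equalityI)
  show "length (del_nth l (del_nth k xs)) = length (del_nth (k - 1) (del_nth l xs))"
    using assms by simp
  fix i assume "i < length (del_nth l (del_nth k xs))"
  then show "del_nth l (del_nth k xs) ! i = del_nth (k - 1) (del_nth l xs) ! i"
    using assms by (auto simp: nth_del_nth insert_index_def)
qed

text \<open>The positions \<open>k\<close> and \<open>l\<close> both refer to \<open>xs\<close>. Once the entry at \<open>k\<close> is gone, the entry formerly at
\<open>l\<close> sits at \<open>delete_index k l\<close>, one position lower if it came after \<open>k\<close>.\<close>

definition del_two :: "nat \<Rightarrow> nat \<Rightarrow> 'i list \<Rightarrow> 'i list" where
  "del_two k l xs = del_nth (delete_index k l) (del_nth k xs)"

lemma del_two_commute:
  assumes "k < length xs" "l < length xs" "k \<noteq> l"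
  shows "del_two k l xs = del_two l k xs"
  using assms del_nth_del_nth[of l k xs] del_nth_del_nth[of k l xs]
  by (cases k l rule: linorder_cases) (auto simp: del_two_def delete_index_def)

lemma length_del_two:
  assumes "k < length xs" "l < length xs" "k \<noteq> l"
  shows "length (del_two k l xs) = length xs - 2"
  using assms by (auto simp: del_two_def delete_index_def)

lemma nth_del_nth_delete_index:
  assumes "k < length xs" "l < length xs" "k \<noteq> l"
  shows "del_nth k xs ! delete_index k l = xs ! l"
  using assms by (subst nth_del_nth) (auto simp: delete_index_def insert_index_def)

text \<open>Exactly one of the two deletions shifts the other position, so the two exponents have different
parity. This makes the second-order expansion of a Pfaffian antisymmetric in the two leading
entries.\<close>

lemma delete_index_sign_antisym:
  assumes "k \<noteq> l"
  shows "(-1 :: 'a::comm_ring_1) ^ (k + delete_index k l) = - ((-1) ^ (l + delete_index l k))"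
proof (cases "k < l")
  case True
  then obtain p where "l = Suc p" by (cases l) auto
  with True show ?thesis by (simp add: delete_index_def add.commute)
next
  case False
  with assms obtain p where "k = Suc p" by (cases k) auto
  with assms False show ?thesis by (simp add: delete_index_def add.commute)
qed

text \<open>An entry moves to the front by passing the entries before it, one swap each. The lemma serves three
functions: the Pfaffian of a list, and a minor as a function of its row list or of its column list.\<close>

lemma adjacent_antisym_move:
  fixes f :: "'i list \<Rightarrow> 'a::comm_ring_1"
  assumes "\<And>us x y vs. f (us @ x # y # vs) = - f (us @ y # x # vs)"
  shows "f (us @ x # vs) = (-1) ^ length us * f (x # us @ vs)"
proof (induction us arbitrary: vs rule: rev_induct)
  case (snoc u us)
  show ?case using assms[of us u x vs] snoc.IH[of "u # vs"] by simp
qed simp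

lemma adjacent_antisym_nth:
  fixes f :: "'i list \<Rightarrow> 'a::comm_ring_1"
  assumes "\<And>us x y vs. f (us @ x # y # vs) = - f (us @ y # x # vs)" and "k < length xs"
  shows "f xs = (-1) ^ k * f (xs ! k # del_nth k xs)"
proof -
  have "f xs = f (take k xs @ xs ! k # drop (Suc k) xs)"
    using id_take_nth_drop[OF assms(2)] by (rule arg_cong)
  also have "\<dots> = (-1) ^ k * f (xs ! k # del_nth k xs)"
    using adjacent_antisym_move[of f "take k xs" "xs ! k" "drop (Suc k) xs", OF assms(1)] assms(2)
    by (simp add: del_nth_def)
  finally show ?thesis .
qed

section \<open>Sums over ordered pairs of distinct positions\<close>

text \<open>Grouping the ordered pairs by the unordered pair that underlies them turns antisymmetry of the
summand into a cancellation within each group. Unlike the argument that the sum equals its own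
negative, this also works in characteristic \<open>2\<close>.\<close>

lemma sum_offdiag:
  fixes h :: "nat \<Rightarrow> nat \<Rightarrow> 'a::comm_monoid_add"
  shows "(\<Sum>k<n. \<Sum>l\<in>{..<n} - {k}. h k l) = (\<Sum>(i, j)\<in>{(i, j). i < j \<and> j < n}. h i j + h j i)"
proof -
  define P where "P = {(i, j). i < j \<and> j < n}"
  have fin: "finite P"
    unfolding P_def by (rule finite_subset[of _ "{..<n} \<times> {..<n}"]) auto
  have "(\<Sum>k<n. \<Sum>l\<in>{..<n} - {k}. h k l) = (\<Sum>(k, l)\<in>(SIGMA k:{..<n}. {..<n} - {k}). h k l)"
    by (simp add: sum.Sigma)
  also have "(SIGMA k:{..<n}. {..<n} - {k}) = P \<union> prod.swap ` P"
    by (auto simp: P_def image_iff)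
  also have "(\<Sum>(k, l)\<in>P \<union> prod.swap ` P. h k l)
      = (\<Sum>(k, l)\<in>P. h k l) + (\<Sum>(k, l)\<in>prod.swap ` P. h k l)"
    using fin by (intro sum.union_disjoint) (auto simp: P_def)
  also have "(\<Sum>(k, l)\<in>prod.swap ` P. h k l) = (\<Sum>(k, l)\<in>P. h l k)"
    by (subst sum.reindex) (auto simp: case_prod_beta)
  finally show ?thesis unfolding P_def[symmetric] by (simp add: sum.distrib case_prod_beta)
qed

lemma sum_offdiag_swap:
  fixes h :: "nat \<Rightarrow> nat \<Rightarrow> 'a::comm_monoid_add"
  shows "(\<Sum>k<n. \<Sum>l\<in>{..<n} - {k}. h k l) = (\<Sum>k<n. \<Sum>l\<in>{..<n} - {k}. h l k)"
  unfolding sum_offdiag by (simp add: add.commute)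

lemma sum_offdiag_antisym:
  fixes h :: "nat \<Rightarrow> nat \<Rightarrow> 'a::ab_group_add"
  assumes "\<And>k l. k < n \<Longrightarrow> l < n \<Longrightarrow> k \<noteq> l \<Longrightarrow> h k l = - h l k"
  shows "(\<Sum>k<n. \<Sum>l\<in>{..<n} - {k}. h k l) = 0"
proof -
  have "h i j + h j i = 0" if "i < j" "j < n" for i j
    using assms[of i j] that by simp
  then show ?thesis unfolding sum_offdiag by (intro sum.neutral) auto
qed

section \<open>The Pfaffian of a list of indices\<close>

text \<open>The expansion of a Pfaffian along its first row, with the index set presented as a list. Lists that
are not increasing, or that repeat an index, are allowed: antisymmetry under permutations of the
list then carries the signs that would otherwise depend on the relative order of indices.\<close>

function pf_list :: "('i \<Rightarrow> 'i \<Rightarrow> 'a::comm_ring_1) \<Rightarrow> 'i list \<Rightarrow> 'a" where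
  "pf_list A [] = 1"
| "pf_list A (x # xs) = (\<Sum>k<length xs. (-1) ^ k * A x (xs ! k) * pf_list A (del_nth k xs))"
  by pat_completeness auto
termination by (relation "measure (length \<circ> snd)") auto

lemma pf_list_map: "pf_list A (map f xs) = pf_list (\<lambda>x y. A (f x) (f y)) xs"
proof (induction "length xs" arbitrary: xs rule: less_induct)
  case less
  show ?case
  proof (cases xs)
    case (Cons x ys)
    have "del_nth k (map f ys) = map f (del_nth k ys)" for k
      by (simp add: del_nth_def take_map drop_map)
    then show ?thesis using less Cons by (auto intro!: sum.cong)
  qed simp
qed

lemma pf_list_cong:
  assumes "\<And>x y. x \<in> set xs \<Longrightarrow> y \<in> set xs \<Longrightarrow> A x y = B x y"
  shows "pf_list A xs = pf_list B xs"
  using assms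
proof (induction "length xs" arbitrary: xs rule: less_induct)
  case less
  show ?case
  proof (cases xs)
    case (Cons x ys)
    have sub: "set (del_nth k ys) \<subseteq> set ys" for k
      by (auto simp: del_nth_def dest: in_set_takeD in_set_dropD)
    have "pf_list A (del_nth k ys) = pf_list B (del_nth k ys)" if "k < length ys" for k
    proof (rule less.hyps)
      show "A x y = B x y" if "x \<in> set (del_nth k ys)" "y \<in> set (del_nth k ys)" for x y
        using less.prems[of x y] sub[of k] that Cons by auto
    qed (use that Cons in simp)
    then show ?thesis using less.prems Cons by (auto intro!: sum.cong)
  qed simp
qed

lemma sum_delete_index:
  fixes g :: "nat \<Rightarrow> 'a::comm_monoid_add"
  assumes "k < n"
  shows "(\<Sum>l<n - Suc 0. g l) = (\<Sum>l\<in>{..<n} - {k}. g (delete_index k l))"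
proof -
  have img: "insert_index k ` {..<n - Suc 0} = {..<n} - {k}"
    using insert_index_image[of k "n - 1"] assms by (simp add: atLeast0LessThan)
  have "(\<Sum>l<n - Suc 0. g l) = (\<Sum>l<n - Suc 0. g (delete_index k (insert_index k l)))"
    by simp
  also have "\<dots> = (\<Sum>l\<in>insert_index k ` {..<n - Suc 0}. g (delete_index k l))"
    by (subst sum.reindex) (auto simp: insert_index_inj_on)
  finally show ?thesis unfolding img .
qed

text \<open>The expansion along the first two rows. The antisymmetry of Pfaffians is read off
from it: the double sum exchanges \<open>x\<close> and \<open>y\<close> with a change of sign when \<open>k\<close> and \<open>l\<close> are exchanged.\<close>

lemma pf_list_expand_two:
  "pf_list A (x # y # zs) = A x y * pf_list A zs -
     (\<Sum>k<length zs. \<Sum>l\<in>{..<length zs} - {k}.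
        (-1) ^ (k + delete_index k l) * A x (zs ! k) * A y (zs ! l) * pf_list A (del_two k l zs))"
proof -
  let ?n = "length zs"
  have "pf_list A (y # del_nth k zs) = (\<Sum>l\<in>{..<?n} - {k}.
      (-1) ^ delete_index k l * A y (zs ! l) * pf_list A (del_two k l zs))" if "k < ?n" for k
    using that
    by (simp add: sum_delete_index[OF that] nth_del_nth_delete_index del_two_def)
  moreover have "del_nth (Suc k) (y # zs) = y # del_nth k zs" "del_nth 0 (y # zs) = zs" for k
    by (simp_all add: del_nth_def)
  moreover have "pf_list A (x # y # zs)
      = (\<Sum>k<Suc ?n. (-1) ^ k * A x ((y # zs) ! k) * pf_list A (del_nth k (y # zs)))"
    by simp
  ultimately show ?thesis
    unfolding sum.lessThan_Suc_shift
    by (simp add: sum_distrib_left sum_negf power_add mult_ac del: pf_list.simps)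
qed

section \<open>Antisymmetry of the Pfaffian\<close>

locale alternating_form =
  fixes A :: "'i \<Rightarrow> 'i \<Rightarrow> 'a::comm_ring_1"
  assumes self: "A x x = 0" and skew: "A x y = - A y x"
begin

abbreviation pf :: "'i list \<Rightarrow> 'a" where "pf \<equiv> pf_list A"

lemma pf_swap_front: "pf (x # y # zs) = - pf (y # x # zs)"
proof -
  let ?n = "length zs"
  define h where "h x y k l = (-1) ^ (k + delete_index k l) * A x (zs ! k) * A y (zs ! l)
    * pf (del_two k l zs)" for x y k l
  have "h x y k l = - h y x l k" if "k < ?n" "l < ?n" "k \<noteq> l" for k l
    unfolding h_def delete_index_sign_antisym[OF that(3)] del_two_commute[OF that]
    by (simp add: mult_ac)
  then have "(\<Sum>k<?n. \<Sum>l\<in>{..<?n} - {k}. h x y k l) = (\<Sum>k<?n. \<Sum>l\<in>{..<?n} - {k}. - h y x l k)"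
    by (intro sum.cong) auto
  also have "\<dots> = - (\<Sum>k<?n. \<Sum>l\<in>{..<?n} - {k}. h y x k l)"
    by (subst sum_offdiag_swap) (simp add: sum_negf)
  finally show ?thesis
    using skew[of x y] unfolding pf_list_expand_two h_def[symmetric] by simp
qed

lemma pf_repeat_front: "pf (x # x # zs) = 0"
proof -
  let ?n = "length zs"
  have "(\<Sum>k<?n. \<Sum>l\<in>{..<?n} - {k}. (-1) ^ (k + delete_index k l) * A x (zs ! k) * A x (zs ! l)
      * pf (del_two k l zs)) = 0"
  proof (rule sum_offdiag_antisym)
    fix k l assume kl: "k < ?n" "l < ?n" "k \<noteq> l"
    show "(-1) ^ (k + delete_index k l) * A x (zs ! k) * A x (zs ! l) * pf (del_two k l zs)
      = - ((-1) ^ (l + delete_index l k) * A x (zs ! l) * A x (zs ! k) * pf (del_two l k zs))"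
      unfolding delete_index_sign_antisym[OF kl(3)] del_two_commute[OF kl]
      by (simp add: mult_ac)
  qed
  then show ?thesis by (simp only: pf_list_expand_two self mult_zero_left diff_zero)
qed

text \<open>A swap behind the first entry is reduced to shorter lists by expanding along that entry. Deleting an
entry other than \<open>x\<close> and \<open>y\<close> leaves a shorter list with the same swap; deleting \<open>x\<close> from one list and
from the other gives the same list, but from adjacent positions, hence with opposite signs.\<close>

lemma pf_swap: "pf (us @ x # y # vs) = - pf (us @ y # x # vs)"
proof (induction "length us + length vs" arbitrary: us vs rule: less_induct)
  case less
  show ?case
  proof (cases us)
    case Nil
    then show ?thesis using pf_swap_front[of x y vs] by (simp only: append_Nil)
  next
    case (Cons u ws)
    let ?p = "length ws" and ?w = "ws @ x # y # vs" and ?w' = "ws @ y # x # vs"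
    define n where "n = length ?w"
    \<comment> \<open>matches the position of each entry in the swapped list with its position in the original one\<close>
    let ?t = "Transposition.transpose ?p (Suc ?p)"
    have eq: "(-1) ^ ?t k * A u (?w ! ?t k) * pf (del_nth (?t k) ?w)
        = - ((-1) ^ k * A u (?w' ! k) * pf (del_nth k ?w'))" if k: "k < n" for k
    proof -
      have d1: "del_nth (Suc ?p) ?w = ws @ x # vs" "del_nth (Suc ?p) ?w' = ws @ y # vs"
        by (simp_all add: del_nth_def)
      consider "k < ?p" | "k = ?p" | "k = Suc ?p" | "Suc ?p < k" by linarith
      then show ?thesis
      proof cases
        case 1
        then have "del_nth k (ws @ zs) = del_nth k ws @ zs" for zs
          by (simp add: del_nth_def)
        with 1 less.hyps[of "del_nth k ws" vs] Cons show ?thesis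
          by (simp add: Transposition.transpose_def nth_append)
      next
        case 2
        then show ?thesis by (simp add: d1 nth_append)
      next
        case 3
        then show ?thesis by (simp add: d1 nth_append)
      next
        case 4
        define q where "q = k - Suc (Suc ?p)"
        have kq: "k = Suc (Suc (?p + q))" "q < length vs" using 4 k by (auto simp: q_def n_def)
        then have "del_nth k (ws @ a # b # vs) = ws @ a # b # del_nth q vs" for a b
          by (simp add: del_nth_def numeral_3_eq_3)
        with kq less.hyps[of ws "del_nth q vs"] Cons show ?thesis
          by (simp add: Transposition.transpose_def nth_append)
      qed
    qed
    have bij: "bij_betw ?t {..<n} {..<n}"
      by (intro permutes_imp_bij permutes_swap_id) (auto simp: n_def)
    have "pf (u # ?w) = (\<Sum>k<n. (-1) ^ k * A u (?w ! k) * pf (del_nth k ?w))"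
      unfolding n_def by (rule pf_list.simps(2))
    also have "\<dots> = (\<Sum>k<n. (-1) ^ ?t k * A u (?w ! ?t k) * pf (del_nth (?t k) ?w))"
      by (rule sum.reindex_bij_betw[OF bij, symmetric])
    also have "\<dots> = (\<Sum>k<n. - ((-1) ^ k * A u (?w' ! k) * pf (del_nth k ?w')))"
      by (rule sum.cong[OF refl]) (simp only: eq lessThan_iff)
    also have "\<dots> = - pf (u # ?w')"
      unfolding sum_negf pf_list.simps(2) n_def by simp
    finally show ?thesis using Cons by simp
  qed
qed

end

section \<open>Minors with listed rows and columns\<close>

definition minor :: "('i \<Rightarrow> 'i \<Rightarrow> 'a::comm_ring_1) \<Rightarrow> 'i list \<Rightarrow> 'i list \<Rightarrow> 'a" where
  "minor A rs cs = det (mat (length rs) (length cs) (\<lambda>(p, q). A (rs ! p) (cs ! q)))"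

lemma minor_Nil: "minor A [] [] = 1"
  by (simp add: minor_def)

lemma minor_transpose:
  "minor A rs cs = minor (\<lambda>x y. A y x) cs rs"
proof (cases "length rs = length cs")
  case True
  let ?M = "mat (length rs) (length rs) (\<lambda>(p, q). A (rs ! p) (cs ! q))"
  have "det ?M = det (transpose_mat ?M)"
    by (rule det_transpose[of _ "length rs", symmetric]) simp
  also have "transpose_mat ?M = mat (length rs) (length rs) (\<lambda>(p, q). A (rs ! q) (cs ! p))"
    by (rule eq_matI) auto
  finally show ?thesis using True by (simp add: minor_def)
qed (simp add: minor_def det_def)

text \<open>If the lengths of the two lists differ, both sides are \<open>0\<close>, the default value of the determinant of
a non-square matrix.\<close>

lemma minor_swap_rows: "minor A (us @ x # y # vs) cs = - minor A (us @ y # x # vs) cs"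
proof (cases "length (us @ x # y # vs) = length cs")
  case True
  let ?p = "length us" and ?n = "length cs"
  let ?M = "\<lambda>rs. mat ?n ?n (\<lambda>(p, q). A (rs ! p) (cs ! q))"
  have "?M (us @ y # x # vs) = swaprows ?p (Suc ?p) (?M (us @ x # y # vs))"
    using True by (intro eq_matI) (auto simp: nth_append nth_Cons split: nat.splits)
  also have "det \<dots> = - det (?M (us @ x # y # vs))"
    using True by (intro det_swaprows[of _ ?n]) auto
  finally show ?thesis using True by (simp add: minor_def)
qed (simp add: minor_def det_def)

lemma minor_swap_cols: "minor A rs (us @ x # y # vs) = - minor A rs (us @ y # x # vs)"
  unfolding minor_transpose[of A rs] by (rule minor_swap_rows)

lemma minor_expand_row:
  assumes "length cs = Suc (length rs)"
  shows "minor A (i # rs) cs = (\<Sum>l<length cs. (-1) ^ l * A i (cs ! l) * minor A rs (del_nth l cs))"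
proof -
  let ?n = "length cs"
  let ?M = "mat ?n ?n (\<lambda>(p, q). A ((i # rs) ! p) (cs ! q))"
  have "mat_delete ?M 0 l = mat (length rs) (length (del_nth l cs)) (\<lambda>(p, q). A (rs ! p) (del_nth l cs ! q))"
    if "l < ?n" for l
    using that assms
    by (intro eq_matI) (auto simp: mat_delete_def nth_del_nth insert_index_def)
  then have "cofactor ?M 0 l = (-1) ^ l * minor A rs (del_nth l cs)" if "l < ?n" for l
    using that by (simp add: cofactor_def minor_def)
  moreover have "det ?M = (\<Sum>l<?n. ?M $$ (0, l) * cofactor ?M 0 l)"
    using assms by (intro laplace_expansion_row) auto
  ultimately show ?thesis using assms by (auto simp: minor_def mult_ac intro!: sum.cong)
qed

lemma minor_expand_col:
  assumes "length rs = Suc (length cs)"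
  shows "minor A rs (j # cs) = (\<Sum>k<length rs. (-1) ^ k * A (rs ! k) j * minor A (del_nth k rs) cs)"
  unfolding minor_transpose[of A rs] minor_expand_row[OF assms]
  by (simp add: minor_transpose[of A _ cs])

text \<open>Expanding a bordered determinant along its first row and then along its first column.\<close>

lemma minor_expand_border:
  "minor A (i # xs) (j # xs) = A i j * minor A xs xs -
    (\<Sum>k<length xs. \<Sum>l<length xs. (-1) ^ (k + l) * A i (xs ! l) * A (xs ! k) j
       * minor A (del_nth k xs) (del_nth l xs))"
proof -
  let ?n = "length xs"
  have "minor A xs (j # del_nth l xs)
      = (\<Sum>k<?n. (-1) ^ k * A (xs ! k) j * minor A (del_nth k xs) (del_nth l xs))" if "l < ?n" for l
    using that by (intro minor_expand_col) auto
  moreover have "del_nth (Suc l) (j # xs) = j # del_nth l xs" "del_nth 0 (j # xs) = xs" for l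
    by (simp_all add: del_nth_def)
  moreover have "minor A (i # xs) (j # xs)
      = (\<Sum>l<Suc ?n. (-1) ^ l * A i ((j # xs) ! l) * minor A xs (del_nth l (j # xs)))"
    by (subst minor_expand_row) simp_all
  ultimately have "minor A (i # xs) (j # xs) = A i j * minor A xs xs -
    (\<Sum>l<?n. \<Sum>k<?n. (-1) ^ (k + l) * A i (xs ! l) * A (xs ! k) j
       * minor A (del_nth k xs) (del_nth l xs))"
    unfolding sum.lessThan_Suc_shift
    by (simp add: sum_distrib_left sum_negf power_add mult_ac)
  also have "(\<Sum>l<?n. \<Sum>k<?n. (-1) ^ (k + l) * A i (xs ! l) * A (xs ! k) j
       * minor A (del_nth k xs) (del_nth l xs)) = (\<Sum>k<?n. \<Sum>l<?n. (-1) ^ (k + l) * A i (xs ! l) * A (xs ! k) j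
       * minor A (del_nth k xs) (del_nth l xs))"
    by (rule sum.swap)
  finally show ?thesis .
qed

text \<open>If row \<open>k\<close> and column \<open>l\<close> are struck out, then index \<open>l\<close> survives among the rows only and index \<open>k\<close>
among the columns only. Moving both to the front displays the minor as a bordered principal minor
with two rows fewer, which is the shape needed for an induction.\<close>

lemma minor_del_nth:
  assumes "k < length xs" "l < length xs" "k \<noteq> l"
  shows "minor A (del_nth k xs) (del_nth l xs) = (-1) ^ (delete_index k l + delete_index l k)
    * minor A (xs ! l # del_two k l xs) (xs ! k # del_two k l xs)"
proof -
  have len: "delete_index k l < length (del_nth k xs)" "delete_index l k < length (del_nth l xs)"
    using assms by (auto simp: delete_index_def)
  have "minor A (del_nth k xs) (del_nth l xs)
      = (-1) ^ delete_index k l * minor A (xs ! l # del_two k l xs) (del_nth l xs)"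
    using adjacent_antisym_nth[where f = "\<lambda>rs. minor A rs (del_nth l xs)", OF minor_swap_rows len(1)]
    by (simp add: nth_del_nth_delete_index[OF assms] del_two_def)
  also have "minor A (xs ! l # del_two k l xs) (del_nth l xs) = (-1) ^ delete_index l k
      * minor A (xs ! l # del_two k l xs) (xs ! k # del_two l k xs)"
    using adjacent_antisym_nth[where f = "\<lambda>cs. minor A (xs ! l # del_two k l xs) cs",
        OF minor_swap_cols len(2)]
    by (simp add: nth_del_nth_delete_index[OF assms(2,1) assms(3)[symmetric]] del_two_def)
  finally show ?thesis
    by (simp add: power_add mult.assoc del_two_commute[OF assms(2,1) assms(3)[symmetric]])
qed

lemma minus_one_power_mult_self: "(-1 :: 'a::comm_ring_1) ^ n * ((-1) ^ n * x) = x"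
  by (simp flip: mult.assoc power_add)

section \<open>Bordered minors of an alternating form\<close>

context alternating_form
begin

lemma pf_del_nth:
  assumes "k < length xs" "l < length xs" "k \<noteq> l"
  shows "pf (del_nth k xs) = (-1) ^ delete_index k l * pf (xs ! l # del_two k l xs)"
proof -
  have len: "delete_index k l < length (del_nth k xs)"
    using assms by (auto simp: delete_index_def)
  show ?thesis
    using adjacent_antisym_nth[of pf, OF pf_swap len]
    by (simp only: nth_del_nth_delete_index[OF assms] del_two_def)
qed

lemma pf_two_to_front:
  assumes "k < length xs" "l < length xs" "k \<noteq> l"
  shows "pf (xs ! l # xs ! k # del_two k l xs) = - ((-1) ^ (k + delete_index k l) * pf xs)"
proof -
  let ?x = "xs ! k" and ?y = "xs ! l" and ?T = "del_two k l xs"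
  have len: "delete_index k l < length (del_nth k xs)"
    using assms by (auto simp: delete_index_def)
  have "pf xs = (-1) ^ k * pf (?x # del_nth k xs)"
    by (rule adjacent_antisym_nth[of pf, OF pf_swap assms(1)])
  also have "pf (?x # del_nth k xs) = (-1) ^ delete_index k l * pf (?x # ?y # ?T)"
    using adjacent_antisym_nth[of "\<lambda>zs. pf (?x # zs)", OF pf_swap[of "?x # us" for us, simplified append_Cons] len]
    by (simp only: nth_del_nth_delete_index[OF assms] del_two_def)
  finally have "pf xs = (-1) ^ (k + delete_index k l) * pf (?x # ?y # ?T)"
    by (simp only: power_add mult.assoc)
  then have "(-1) ^ (k + delete_index k l) * pf xs = pf (?x # ?y # ?T)"
    by (simp only: minus_one_power_mult_self)
  then show ?thesis using pf_swap_front[of ?y ?x ?T] by (simp only:)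
qed

text \<open>This determines all minors of an alternating matrix that miss being principal in at most one row and
one column; \<open>i = j\<close> gives the principal minors themselves, that is Cayley's theorem. The border
expansion involves \<open>minor A xs xs\<close> and the minors of \<open>xs\<close> with one row and one column deleted. Apart from the empty
minor, these are bordered minors over shorter lists, so the induction hypothesis evaluates them.

For odd length, \<open>minor A xs xs\<close> vanishes and the other minors factor as
\<open>pf (del_nth k xs) * pf (del_nth l xs)\<close>, so the double sum is the product of the first-row expansions
of \<open>pf (i # xs)\<close> and \<open>pf (j # xs)\<close>. For even length, \<open>minor A xs xs\<close> is a square, the minors with
\<open>k = l\<close> vanish, and each of the others is, up to sign, \<open>pf xs * pf (del_two k l xs)\<close>. After the factor
\<open>pf xs\<close> is taken out, the expansion of \<open>pf (i # j # xs)\<close> along its first two rows remains.\<close>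

lemma bordered_minor:
  "minor A (i # xs) (j # xs)
    = (if even (length xs) then pf xs * pf (i # j # xs) else pf (i # xs) * pf (j # xs))"
proof (induction "length xs" arbitrary: i j xs rule: less_induct)
  case less
  let ?n = "length xs"
  \<comment> \<open>the odd case vanishes because the index \<open>y\<close> then occurs twice in a Pfaffian\<close>
  have principal: "minor A ys ys = (if even (length ys) then pf ys * pf ys else 0)"
    if "length ys \<le> ?n" for ys
  proof (cases ys)
    case Nil
    then show ?thesis by (simp add: minor_Nil)
  next
    case (Cons y zs)
    with that less.hyps[of zs y y] show ?thesis by (simp add: pf_repeat_front del: pf_list.simps)
  qed
  let ?S = "\<lambda>k l. (-1) ^ (k + l) * A i (xs ! l) * A (xs ! k) j * minor A (del_nth k xs) (del_nth l xs)"
  note expand = minor_expand_border[of A i xs j]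
  show ?case
  proof (cases "even ?n")
    case False
    have m: "minor A (del_nth k xs) (del_nth l xs) = pf (del_nth k xs) * pf (del_nth l xs)"
      if kl: "k < ?n" "l < ?n" for k l
    proof (cases "k = l")
      case True
      with principal[of "del_nth k xs"] kl False show ?thesis by simp
    next
      case ne: False
      have "minor A (xs ! l # del_two k l xs) (xs ! k # del_two k l xs)
          = pf (xs ! l # del_two k l xs) * pf (xs ! k # del_two k l xs)"
        using less.hyps[of "del_two k l xs" "xs ! l" "xs ! k"] kl ne False
        by (simp add: length_del_two)
      then show ?thesis
        using pf_del_nth[OF kl ne] pf_del_nth[OF kl(2,1) ne[symmetric]]
        by (simp add: minor_del_nth[OF kl ne] del_two_commute[OF kl(2,1) ne[symmetric]]
            power_add mult_ac)
    qed
    have "minor A (i # xs) (j # xs) = - (\<Sum>k<?n. \<Sum>l<?n. ?S k l)"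
      using False by (simp add: expand principal)
    also have "\<dots> = (\<Sum>k<?n. \<Sum>l<?n. ((-1) ^ l * A i (xs ! l) * pf (del_nth l xs))
        * ((-1) ^ k * A j (xs ! k) * pf (del_nth k xs)))"
      unfolding sum_negf[symmetric]
    proof (intro sum.cong refl)
      fix k l assume "k \<in> {..<?n}" "l \<in> {..<?n}"
      then show "- ?S k l = ((-1) ^ l * A i (xs ! l) * pf (del_nth l xs))
        * ((-1) ^ k * A j (xs ! k) * pf (del_nth k xs))"
        using m[of k l] skew[of "xs ! k" j] by (simp add: power_add mult_ac)
    qed
    also have "\<dots> = pf (i # xs) * pf (j # xs)"
      by (subst sum.swap) (simp add: sum_product)
    finally show ?thesis using False by simp
  next
    case True
    let ?D = "\<lambda>k l. (-1) ^ (k + delete_index k l) * A i (xs ! k) * A j (xs ! l) * pf (del_two k l xs)"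
    have diag: "?S k k = 0" if "k < ?n" for k
      using principal[of "del_nth k xs"] that True by (cases xs) simp_all
    have off: "?S k l = pf xs * ?D l k" if kl: "k < ?n" "l < ?n" "k \<noteq> l" for k l
    proof -
      have "minor A (xs ! l # del_two k l xs) (xs ! k # del_two k l xs)
          = - ((-1) ^ (k + delete_index k l) * (pf (del_two k l xs) * pf xs))"
        using less.hyps[of "del_two k l xs" "xs ! l" "xs ! k"] kl True pf_two_to_front[OF kl]
        by (simp add: length_del_two mult_ac del: pf_list.simps)
      then have "minor A (del_nth k xs) (del_nth l xs)
          = - ((-1) ^ delete_index k l * ((-1) ^ delete_index k l *
               ((-1) ^ k * ((-1) ^ delete_index l k * (pf (del_two k l xs) * pf xs)))))"
        by (simp add: minor_del_nth[OF kl] power_add mult_ac)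
      then have "minor A (del_nth k xs) (del_nth l xs)
          = - ((-1) ^ k * ((-1) ^ delete_index l k * (pf (del_two k l xs) * pf xs)))"
        by (simp only: minus_one_power_mult_self)
      then have "?S k l = (-1) ^ k * ((-1) ^ k * ((-1) ^ l * ((-1) ^ delete_index l k
          * (A i (xs ! l) * (A j (xs ! k) * (pf (del_two k l xs) * pf xs))))))"
        using skew[of "xs ! k" j] by (simp add: power_add mult_ac)
      also have "\<dots> = (-1) ^ l * ((-1) ^ delete_index l k
          * (A i (xs ! l) * (A j (xs ! k) * (pf (del_two k l xs) * pf xs))))"
        by (rule minus_one_power_mult_self)
      finally show ?thesis
        by (simp add: power_add mult_ac del_two_commute[OF kl(2,1) kl(3)[symmetric]])
    qed
    have "(\<Sum>l<?n. ?S k l) = (\<Sum>l\<in>{..<?n} - {k}. pf xs * ?D l k)" if "k < ?n" for k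
    proof -
      have "(\<Sum>l<?n. ?S k l) = ?S k k + (\<Sum>l\<in>{..<?n} - {k}. ?S k l)"
        using that by (intro sum.remove) auto
      also have "(\<Sum>l\<in>{..<?n} - {k}. ?S k l) = (\<Sum>l\<in>{..<?n} - {k}. pf xs * ?D l k)"
        using that by (intro sum.cong off) auto
      finally show ?thesis using diag[OF that] by simp
    qed
    then have "(\<Sum>k<?n. \<Sum>l<?n. ?S k l) = (\<Sum>k<?n. \<Sum>l\<in>{..<?n} - {k}. pf xs * ?D l k)"
      by simp
    also have "\<dots> = pf xs * (\<Sum>k<?n. \<Sum>l\<in>{..<?n} - {k}. ?D k l)"
      by (subst sum_offdiag_swap) (simp add: sum_distrib_left)
    finally show ?thesis
      using True by (simp add: expand principal pf_list_expand_two right_diff_distrib mult_ac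
          del: pf_list.simps)
  qed
qed

end

section \<open>The sum over perfect matchings\<close>

text \<open>The sum that defines the Pfaffian, for an arbitrary finite index set instead of an initial
segment: removing the two ends of an edge leaves a set with a gap.\<close>

definition matching_sum :: "(nat \<Rightarrow> nat \<Rightarrow> 'a::comm_ring_1) \<Rightarrow> nat set \<Rightarrow> 'a" where
  "matching_sum A V = (\<Sum>\<mu>\<in>perfect_matchings V.
     (-1) ^ card (crossings \<mu>) * (\<Prod>(i, j)\<in>{(i, j). i < j \<and> {i, j} \<in> \<mu>}. A i j))"

lemma matching_edge_subset: "\<mu> \<in> perfect_matchings V \<Longrightarrow> e \<in> \<mu> \<Longrightarrow> e \<subseteq> V"
  by (auto simp: perfect_matchings_def partition_on_def)

lemma matching_edge_unique:
  assumes "\<mu> \<in> perfect_matchings V" "e \<in> \<mu>" "e' \<in> \<mu>" "x \<in> e" "x \<in> e'"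
  shows "e = e'"
  using assms by (auto simp: perfect_matchings_def partition_on_def disjoint_def)

lemma finite_perfect_matchings: "finite V \<Longrightarrow> finite (perfect_matchings V)"
  by (rule finite_subset[of _ "Pow (Pow V)"]) (auto dest: matching_edge_subset)

lemma insert_edge_matching:
  assumes "x \<in> V" "y \<in> V" "x \<noteq> y" "\<nu> \<in> perfect_matchings (V - {x, y})"
  shows "insert {x, y} \<nu> \<in> perfect_matchings V"
proof -
  have "disjnt {x, y} (\<Union>\<nu>)"
    using matching_edge_subset[OF assms(4)] by (auto simp: disjnt_def)
  with assms show ?thesis
    by (auto simp: perfect_matchings_def partition_on_insert)
qed

lemma remove_edge_matching:
  assumes "\<mu> \<in> perfect_matchings V" "{x, y} \<in> \<mu>"
  shows "\<mu> - {{x, y}} \<in> perfect_matchings (V - {x, y})"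
proof -
  have "disjnt {x, y} (\<Union>(\<mu> - {{x, y}}))"
    using matching_edge_unique[OF assms(1) assms(2)] by (fastforce simp: disjnt_def)
  from partition_on_insert[OF this, of V] assms show ?thesis
    by (auto simp: perfect_matchings_def insert_absorb)
qed

lemma perfect_matchings_rec:
  assumes "x \<in> V"
  shows "perfect_matchings V = (\<Union>y\<in>V - {x}. insert {x, y} ` perfect_matchings (V - {x, y}))"
proof (intro subset_antisym subsetI)
  fix \<mu> assume \<mu>: "\<mu> \<in> perfect_matchings V"
  from \<mu> assms obtain e where e: "e \<in> \<mu>" "x \<in> e" "card e = 2"
    by (auto simp: perfect_matchings_def partition_on_def)
  then obtain y where y: "e = {x, y}" "x \<noteq> y"
    by (auto simp: card_2_iff)
  have "\<mu> = insert {x, y} (\<mu> - {{x, y}})" using e y by auto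
  with remove_edge_matching[OF \<mu>, of x y] e y matching_edge_subset[OF \<mu>, of e]
  show "\<mu> \<in> (\<Union>y\<in>V - {x}. insert {x, y} ` perfect_matchings (V - {x, y}))" by blast
qed (use insert_edge_matching[OF assms] in auto)

lemma even_count_closed_edges:
  fixes S :: "nat set"
  assumes \<nu>: "\<nu> \<in> perfect_matchings W"
  shows "even (card (\<Union>{e \<in> \<nu>. e \<subseteq> S}))"
proof -
  let ?E = "{e \<in> \<nu>. e \<subseteq> S}"
  have two: "card e = 2" if "e \<in> ?E" for e
    using that \<nu> by (auto simp: perfect_matchings_def)
  have "card (\<Union>?E) = sum card ?E"
    using \<nu> two by (intro card_Union_disjoint)
      (auto simp: perfect_matchings_def partition_on_def intro: pairwise_subset card_ge_0_finite)
  also have "\<dots> = 2 * card ?E" using two by simp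
  finally show ?thesis by simp
qed

text \<open>As \<open>x\<close> is minimal, an edge crosses \<open>{x, y}\<close> iff exactly one of its ends lies strictly between \<open>x\<close> and
\<open>y\<close>. The vertices between \<open>x\<close> and \<open>y\<close> consist of one end of each crossing edge and both ends of each
edge that stays between them, so their number has the parity of the number of crossings.\<close>

lemma card_crossings_insert_min:
  assumes V: "finite V" "x \<in> V" "y \<in> V" "x \<noteq> y" "\<And>z. z \<in> V \<Longrightarrow> x \<le> z"
    and \<nu>: "\<nu> \<in> perfect_matchings (V - {x, y})"
  shows "(-1 :: 'a::comm_ring_1) ^ card (crossings (insert {x, y} \<nu>))
    = (-1) ^ card {z \<in> V. x < z \<and> z < y} * (-1) ^ card (crossings \<nu>)"
proof -
  \<comment> \<open>the edges of \<open>\<nu>\<close> that cross \<open>{x, y}\<close>\<close>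
  define C where "C = {(b, d). x < b \<and> b < y \<and> y < d \<and> {b, d} \<in> \<nu>}"
  \<comment> \<open>the vertices under the edge \<open>{x, y}\<close>\<close>
  define S where "S = {z \<in> V. x < z \<and> z < y}"
  have xy: "x < y" using V by force
  have sub: "a \<in> V - {x, y}" "b \<in> V - {x, y}" if "{a, b} \<in> \<nu>" for a b
    using matching_edge_subset[OF \<nu> that] by auto
  have gt: "x < a" "x < b" if "{a, b} \<in> \<nu>" for a b
    using sub[OF that] V(5)[of a] V(5)[of b] by auto
  have finC: "finite C"
    by (rule finite_subset[of _ "V \<times> V"]) (use V(1) sub in \<open>auto simp: C_def\<close>)
  have finX: "finite (crossings \<nu>)"
    by (rule finite_subset[of _ "V \<times> V \<times> V \<times> V"]) (use V(1) sub in \<open>auto simp: crossings_def\<close>)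
  have "crossings (insert {x, y} \<nu>) = crossings \<nu> \<union> (\<lambda>(b, d). (x, b, y, d)) ` C"
  proof (intro subset_antisym subsetI)
    fix c assume "c \<in> crossings (insert {x, y} \<nu>)"
    then obtain i j k l where c: "c = (i, j, k, l)" "i < j" "j < k" "k < l"
      "{i, k} \<in> insert {x, y} \<nu>" "{j, l} \<in> insert {x, y} \<nu>"
      by (auto simp: crossings_def)
    have "x \<le> i" using c(5) gt[of i k] xy by (auto simp: doubleton_eq_iff)
    then have jl: "{j, l} \<in> \<nu>" using c xy by (auto simp: doubleton_eq_iff)
    show "c \<in> crossings \<nu> \<union> (\<lambda>(b, d). (x, b, y, d)) ` C"
    proof (cases "{i, k} \<in> \<nu>")
      case True
      then show ?thesis using c jl by (auto simp: crossings_def)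
    next
      case False
      then have "i = x" "k = y" using c xy by (auto simp: doubleton_eq_iff)
      then show ?thesis using c jl by (auto simp: C_def image_iff)
    qed
  next
    fix c assume "c \<in> crossings \<nu> \<union> (\<lambda>(b, d). (x, b, y, d)) ` C"
    then show "c \<in> crossings (insert {x, y} \<nu>)"
      by (auto simp: crossings_def C_def)
  qed
  moreover have "crossings \<nu> \<inter> (\<lambda>(b, d). (x, b, y, d)) ` C = {}"
    using gt by (auto simp: crossings_def)
  ultimately have "card (crossings (insert {x, y} \<nu>)) = card (crossings \<nu>) + card ((\<lambda>(b, d). (x, b, y, d)) ` C)"
    using finX finC by (simp add: card_Un_disjoint)
  also have "card ((\<lambda>(b, d). (x, b, y, d)) ` C) = card C"
    by (rule card_image) (auto simp: inj_on_def)
  also have "card C = card (fst ` C)"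
  proof (rule card_image[symmetric], rule inj_onI)
    fix p q assume pq: "p \<in> C" "q \<in> C" "fst p = fst q"
    then obtain b d d' where eq: "p = (b, d)" "q = (b, d')" by (cases p, cases q) auto
    with pq have "{b, d} = {b, d'}"
      by (intro matching_edge_unique[OF \<nu>, of _ _ b]) (auto simp: C_def)
    with eq show "p = q" by (auto simp: doubleton_eq_iff)
  qed
  finally have card1: "card (crossings (insert {x, y} \<nu>)) = card (crossings \<nu>) + card (fst ` C)" .
  have S_split: "S = fst ` C \<union> \<Union>{e \<in> \<nu>. e \<subseteq> S}"
  proof (intro subset_antisym subsetI)
    fix b assume b: "b \<in> S"
    then have "b \<in> V - {x, y}" by (auto simp: S_def)
    then obtain e where e: "e \<in> \<nu>" "b \<in> e" "card e = 2"
      using \<nu> by (auto simp: perfect_matchings_def partition_on_def)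
    then obtain d where d: "e = {b, d}" "b \<noteq> d" by (auto simp: card_2_iff)
    show "b \<in> fst ` C \<union> \<Union>{e \<in> \<nu>. e \<subseteq> S}"
    proof (cases "d < y")
      case True
      then have "e \<subseteq> S" using b d e sub[of b d] gt[of b d] by (auto simp: S_def)
      then show ?thesis using e by auto
    next
      case False
      then have "(b, d) \<in> C" using b d e sub[of b d] by (auto simp: C_def S_def)
      then show ?thesis by force
    qed
  next
    fix b assume "b \<in> fst ` C \<union> \<Union>{e \<in> \<nu>. e \<subseteq> S}"
    then show "b \<in> S" using sub by (auto simp: C_def S_def)
  qed
  have disj: "fst ` C \<inter> \<Union>{e \<in> \<nu>. e \<subseteq> S} = {}"
  proof -
    have False if "(b, d) \<in> C" "e \<in> \<nu>" "e \<subseteq> S" "b \<in> e" for b d e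
    proof -
      have "e = {b, d}"
        using that by (intro matching_edge_unique[OF \<nu>, of _ _ b]) (auto simp: C_def)
      then show False using that by (auto simp: C_def S_def)
    qed
    then show ?thesis by fastforce
  qed
  have finS: "finite S" using V(1) by (simp add: S_def)
  then have "card S = card (fst ` C) + card (\<Union>{e \<in> \<nu>. e \<subseteq> S})"
    using card_Un_disjoint[OF _ _ disj] S_split by (metis finite_Un)
  moreover have "even (card (\<Union>{e \<in> \<nu>. e \<subseteq> S}))"
    by (rule even_count_closed_edges[OF \<nu>])
  ultimately have "(-1 :: 'a) ^ card S = (-1) ^ card (fst ` C)"
    by (simp add: power_add)
  then show ?thesis unfolding card1 S_def[symmetric] by (simp add: power_add mult.commute)
qed

text \<open>The first-row expansion, obtained by sorting the matchings according to the partner \<open>y\<close> of the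
smallest vertex \<open>x\<close>.\<close>

lemma matching_sum_expand_min:
  assumes V: "finite V" "x \<in> V" "\<And>z. z \<in> V \<Longrightarrow> x \<le> z"
  shows "matching_sum A V = (\<Sum>y\<in>V - {x}. (-1) ^ card {z \<in> V. x < z \<and> z < y} * A x y
    * matching_sum A (V - {x, y}))"
proof -
  let ?M = "\<lambda>y. perfect_matchings (V - {x, y})"
  let ?t = "\<lambda>\<mu>. (-1) ^ card (crossings \<mu>) * (\<Prod>(i, j)\<in>{(i, j). i < j \<and> {i, j} \<in> \<mu>}. A i j)"
  have not_in: "{x, y} \<notin> \<nu>" if "\<nu> \<in> ?M y" for y \<nu>
    using matching_edge_subset[OF that, of "{x, y}"] by auto
  have disj: "insert {x, y} ` ?M y \<inter> insert {x, y'} ` ?M y' = {}"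
    if "y \<in> V - {x}" "y' \<in> V - {x}" "y \<noteq> y'" for y y'
  proof -
    have False if "insert {x, y} \<nu> = insert {x, y'} \<nu>'" "\<nu> \<in> ?M y" "\<nu>' \<in> ?M y'" for \<nu> \<nu>'
    proof -
      have "{x, y'} \<noteq> {x, y}" using \<open>y \<noteq> y'\<close> by (simp add: doubleton_eq_iff)
      moreover have "{x, y'} \<in> insert {x, y} \<nu>" unfolding that(1) by (rule insertI1)
      ultimately have "{x, y'} \<in> \<nu>" by (simp only: insert_iff simp_thms)
      then show False using matching_edge_subset[OF that(2)] by auto
    qed
    then show ?thesis by blast
  qed
  have weight: "?t (insert {x, y} \<nu>) = (-1) ^ card {z \<in> V. x < z \<and> z < y} * A x y * ?t \<nu>"
    if y: "y \<in> V - {x}" and \<nu>: "\<nu> \<in> ?M y" for y \<nu>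
  proof -
    have xy: "x < y" using y V(3)[of y] by auto
    let ?P = "{(i, j). i < j \<and> {i, j} \<in> \<nu>}"
    have fin: "finite ?P"
      by (rule finite_subset[of _ "V \<times> V"]) (use V(1) matching_edge_subset[OF \<nu>] in auto)
    have "{(i, j). i < j \<and> {i, j} \<in> insert {x, y} \<nu>} = insert (x, y) ?P"
      using xy by (auto simp: doubleton_eq_iff)
    moreover have "(x, y) \<notin> ?P" using not_in[OF \<nu>] by auto
    ultimately have "(\<Prod>(i, j)\<in>{(i, j). i < j \<and> {i, j} \<in> insert {x, y} \<nu>}. A i j)
        = A x y * (\<Prod>(i, j)\<in>?P. A i j)"
      using fin by simp
    then show ?thesis
      using card_crossings_insert_min[OF V(1,2) _ _ V(3) \<nu>, where 'a = 'a] y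
      by (auto simp: mult_ac)
  qed
  have "matching_sum A V = (\<Sum>y\<in>V - {x}. sum ?t (insert {x, y} ` ?M y))"
    unfolding matching_sum_def perfect_matchings_rec[OF V(2)]
    by (intro sum.UNION_disjoint ballI impI disj) (simp_all add: V(1) finite_perfect_matchings)
  also have "\<dots> = (\<Sum>y\<in>V - {x}. \<Sum>\<nu>\<in>?M y. ?t (insert {x, y} \<nu>))"
  proof (rule sum.cong[OF refl])
    fix y
    have "inj_on (insert {x, y}) (?M y)"
      using not_in by (intro inj_onI) (metis insert_ident)
    then show "sum ?t (insert {x, y} ` ?M y) = (\<Sum>\<nu>\<in>?M y. ?t (insert {x, y} \<nu>))"
      by (simp add: sum.reindex)
  qed
  also have "\<dots> = (\<Sum>y\<in>V - {x}. (-1) ^ card {z \<in> V. x < z \<and> z < y} * A x y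
    * matching_sum A (V - {x, y}))"
    unfolding matching_sum_def sum_distrib_left by (intro sum.cong refl weight)
  finally show ?thesis .
qed

lemma sorted_wrt_del_nth:
  assumes "sorted_wrt R xs"
  shows "sorted_wrt R (del_nth k xs)"
proof (cases "k < length xs")
  case True
  have "sorted_wrt R (take k xs @ xs ! k # drop (Suc k) xs)"
    using assms by (simp only: id_take_nth_drop[OF True, symmetric])
  then show ?thesis by (simp add: del_nth_def sorted_wrt_append)
next
  case False
  with assms show ?thesis by (simp add: del_nth_def)
qed

lemma set_del_nth:
  assumes "distinct xs" "k < length xs"
  shows "set (del_nth k xs) = set xs - {xs ! k}"
proof -
  have "set xs = insert (xs ! k) (set (del_nth k xs))"
    using arg_cong[where f = set, OF id_take_nth_drop[OF assms(2)]] by (auto simp: del_nth_def)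
  moreover have "distinct (take k xs @ xs ! k # drop (Suc k) xs)"
    using assms by (simp only: id_take_nth_drop[OF assms(2), symmetric])
  ultimately show ?thesis by (auto simp: del_nth_def)
qed

text \<open>On an increasing list both sides obey the same recursion: the number of entries of \<open>ys\<close> below
\<open>ys ! k\<close> is \<open>k\<close>.\<close>

lemma pf_list_eq_matching_sum:
  "sorted_wrt (<) xs \<Longrightarrow> pf_list A xs = matching_sum A (set xs)"
proof (induction "length xs" arbitrary: xs rule: less_induct)
  case less
  show ?case
  proof (cases xs)
    case Nil
    have "perfect_matchings {} = {{}}" by (auto simp: perfect_matchings_def partition_on_empty)
    moreover have "crossings {} = {}" by (auto simp: crossings_def)
    ultimately show ?thesis using Nil by (simp add: matching_sum_def)
  next
    case (Cons x ys)
    let ?V = "set xs"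
    have srt: "sorted_wrt (<) ys" and gt: "\<And>z. z \<in> set ys \<Longrightarrow> x < z"
      using less.prems Cons by auto
    have dist: "distinct ys" using srt by (simp add: strict_sorted_iff)
    have V: "?V - {x} = set ys" using gt Cons by auto
    have "matching_sum A ?V = (\<Sum>y\<in>set ys. (-1) ^ card {z \<in> ?V. x < z \<and> z < y} * A x y
        * matching_sum A (?V - {x, y}))"
      unfolding V[symmetric] using gt Cons
      by (intro matching_sum_expand_min) (auto intro: less_imp_le)
    also have "\<dots> = (\<Sum>k<length ys. (-1) ^ card {z \<in> ?V. x < z \<and> z < ys ! k} * A x (ys ! k)
        * matching_sum A (?V - {x, ys ! k}))"
      using bij_betw_nth[OF dist refl refl] by (rule sum.reindex_bij_betw[symmetric])
    also have "\<dots> = (\<Sum>k<length ys. (-1) ^ k * A x (ys ! k) * pf_list A (del_nth k ys))"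
    proof (rule sum.cong[OF refl])
      fix k assume "k \<in> {..<length ys}"
      then have k: "k < length ys" by simp
      have "{z \<in> ?V. x < z \<and> z < ys ! k} = (!) ys ` {..<k}"
      proof (intro subset_antisym subsetI)
        fix z assume "z \<in> {z \<in> ?V. x < z \<and> z < ys ! k}"
        then obtain l where l: "l < length ys" "z = ys ! l" "ys ! l < ys ! k"
          using Cons by (auto simp: in_set_conv_nth)
        then have "l < k"
          using sorted_wrt_nth_less[OF srt, of k l] by (cases k l rule: linorder_cases) auto
        with l show "z \<in> (!) ys ` {..<k}" by auto
      qed (use k gt Cons sorted_wrt_nth_less[OF srt] in auto)
      moreover have "inj_on ((!) ys) {..<k}"
        using dist k by (auto simp: inj_on_def nth_eq_iff_index_eq)
      ultimately have card: "card {z \<in> ?V. x < z \<and> z < ys ! k} = k"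
        by (simp add: card_image)
      have "?V - {x, ys ! k} = set (del_nth k ys)"
        using set_del_nth[OF dist k] V by auto
      moreover have "pf_list A (del_nth k ys) = matching_sum A (set (del_nth k ys))"
        using k Cons by (intro less.hyps sorted_wrt_del_nth srt) simp
      ultimately show "(-1) ^ card {z \<in> ?V. x < z \<and> z < ys ! k} * A x (ys ! k)
        * matching_sum A (?V - {x, ys ! k}) = (-1) ^ k * A x (ys ! k) * pf_list A (del_nth k ys)"
        unfolding card by simp
    qed
    finally show ?thesis using Cons by simp
  qed
qed

lemma pfaffian_eq_pf_list: "pfaffian Y = pf_list (\<lambda>i j. Y $$ (i, j)) [0..<dim_row Y]"
  by (subst pf_list_eq_matching_sum)
     (simp_all add: pfaffian_def matching_sum_def atLeast0LessThan)

lemma del_two_upt: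
  assumes "i < m" "j < m" "i \<noteq> j"
  shows "del_two i j [0..<m] = nths [0..<m] (- {i, j})"
proof (rule sorted_distinct_set_unique)
  have d: "distinct (del_nth i [0..<m])"
    using sorted_wrt_del_nth[of "(<)" "[0..<m]" i] by (simp add: strict_sorted_iff)
  have j: "delete_index i j < length (del_nth i [0..<m])" "del_nth i [0..<m] ! delete_index i j = j"
    using assms nth_del_nth_delete_index[of i "[0..<m]" j] by (auto simp: delete_index_def)
  have nths: "set (nths [0..<m] (- {i, j})) = {..<m} - {i, j}"
    by (auto simp: set_nths) (metis add_0 nth_upt)
  show "set (del_two i j [0..<m]) = set (nths [0..<m] (- {i, j}))"
    using assms unfolding del_two_def set_del_nth[OF d j(1)] j(2) nths
    by (subst set_del_nth) auto
  have "sorted_wrt (<) (del_two i j [0..<m])"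
    unfolding del_two_def by (intro sorted_wrt_del_nth) simp
  then show "sorted (del_two i j [0..<m])" "distinct (del_two i j [0..<m])"
    by (simp_all add: strict_sorted_iff)
qed (auto intro: sorted_nths)

lemma pfaffian_delete_two:
  assumes Y: "Y \<in> carrier_mat m m" and ij: "i < m" "j < m" "i \<noteq> j"
  shows "pfaffian (delete_two Y i j) = pf_list (\<lambda>i j. Y $$ (i, j)) (del_two i j [0..<m])"
proof -
  let ?I = "- {i, j}" and ?r = "card {p. p < m \<and> p \<in> - {i, j}}"
  have "pfaffian (delete_two Y i j) = pf_list (\<lambda>p q. Y $$ (pick ?I p, pick ?I q)) [0..<?r]"
    unfolding pfaffian_eq_pf_list delete_two_def dim_submatrix carrier_matD[OF Y]
    by (intro pf_list_cong submatrix_index) (use Y in auto)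
  also have "\<dots> = pf_list (\<lambda>i j. Y $$ (i, j)) (map (pick ?I) [0..<?r])"
    by (rule pf_list_map[symmetric])
  also have "map (pick ?I) [0..<?r] = nths [0..<m] ?I"
  proof (rule nth_equalityI)
    show "length (map (pick ?I) [0..<?r]) = length (nths [0..<m] ?I)"
      by (simp add: length_nths)
    fix p assume "p < length (map (pick ?I) [0..<?r])"
    then have p: "p < ?r" by simp
    then have "pick ?I p < m" using pick_le by blast
    with p show "map (pick ?I) [0..<?r] ! p = nths [0..<m] ?I ! p"
      by (subst nth_nths) auto
  qed
  finally show ?thesis by (simp only: del_two_upt[OF ij])
qed

section \<open>Rank-one perturbation of a skew-symmetric matrix\<close>

text \<open>Subtracting \<open>a $ i\<close> times the border row of the matrix on the right from its row \<open>i\<close> below the border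
clears the first column and leaves \<open>Y + rank1_mat m a b\<close> in the lower right block.\<close>

lemma det_add_rank1:
  fixes Y :: "'a::comm_ring_1 mat"
  assumes Y: "Y \<in> carrier_mat m m"
  shows "det (Y + rank1_mat m a b)
    = det (four_block_mat (1\<^sub>m 1) (mat 1 m (\<lambda>(i, j). - b $ j)) (mat m 1 (\<lambda>(i, j). a $ i)) Y)"
proof -
  define R where "R = mat 1 m (\<lambda>(i, j). - b $ j)"
  define C where "C = mat m 1 (\<lambda>(i, j). a $ i)"
  have R: "R \<in> carrier_mat 1 m" and C: "C \<in> carrier_mat m 1"
    by (simp_all add: R_def C_def)
  let ?N = "four_block_mat (1\<^sub>m 1) R C Y"
  let ?L = "four_block_mat (1\<^sub>m 1) (0\<^sub>m 1 m) (- C) (1\<^sub>m m)"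
  have carrier: "?N \<in> carrier_mat (1 + m) (1 + m)" "?L \<in> carrier_mat (1 + m) (1 + m)"
    using Y by (auto intro: four_block_carrier_mat)
  have C0: "- C + C = 0\<^sub>m m 1" using C by (intro eq_matI) auto
  have CR: "- (C * R) + Y = Y + rank1_mat m a b"
    using Y by (intro eq_matI) (auto simp: rank1_mat_def scalar_prod_def R_def C_def)
  have "?L * ?N = four_block_mat (1\<^sub>m 1) R (0\<^sub>m m 1) (Y + rank1_mat m a b)"
    using Y R C by (subst mult_four_block_mat[of _ 1 1 _ m _ m _ _ 1 _ m]) (simp_all add: C0 CR)
  moreover have "det (four_block_mat (1\<^sub>m 1) R (0\<^sub>m m 1) (Y + rank1_mat m a b))
      = det (Y + rank1_mat m a b)"
    using Y R by (subst det_four_block_mat_lower_left_zero_col[of _ _ m]) (auto simp: rank1_mat_def)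
  moreover have "det ?L = 1"
  proof -
    have "det ?L = det (transpose_mat ?L)"
      by (rule det_transpose[OF carrier(2), symmetric])
    also have "transpose_mat ?L = four_block_mat (1\<^sub>m 1) (transpose_mat (- C)) (0\<^sub>m m 1) (1\<^sub>m m)"
      using C by (subst transpose_four_block_mat[of _ 1 1 _ m _ m]) auto
    also have "det \<dots> = 1"
      using C by (subst det_four_block_mat_lower_left_zero_col[of _ _ m]) auto
    finally show ?thesis .
  qed
  ultimately show ?thesis
    using det_mult[OF carrier(2,1)] unfolding R_def C_def by simp
qed

(* Since indices start at 0, the 1-based sign exponent i + j - 1 becomes
   (i + 1) + (j + 1) - 1 = i + j + 1. *)
theorem proposition8:
  fixes Y M :: "'a::comm_ring_1 mat" and a b :: "'a vec" and m :: nat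
  assumes "even m" and "m > 0"
    and "Y \<in> carrier_mat m m" and "skew_symmetric_mat Y"
    and "a \<in> carrier_vec m" and "b \<in> carrier_vec m"
    and "M = rank1_mat m a b"
  shows "det (Y + M) = pfaffian Y * (pfaffian Y +
    (\<Sum>(i, j)\<in>{(i, j). i < j \<and> j < m}.
      (-1) ^ (i + j + 1) * (a $ i * b $ j - a $ j * b $ i) * pfaffian (delete_two Y i j)))"
proof -
  note Y = assms(3)
  have diag: "Y $$ (i, i) = 0" if "i < m" for i
    using assms(4) Y that by (auto simp: skew_symmetric_mat_def)
  have skewY: "Y $$ (i, j) = - Y $$ (j, i)" if "i < m" "j < m" for i j
  proof -
    have "transpose_mat Y $$ (j, i) = (- Y) $$ (j, i)"
      using assms(4) by (simp add: skew_symmetric_mat_def)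
    then show ?thesis using Y that by simp
  qed
  \<comment> \<open>\<open>Y\<close> enlarged by two indices \<open>m\<close> and \<open>Suc m\<close>, so that row \<open>m\<close> and column \<open>Suc m\<close> form the
    border that occurs in \<open>det_add_rank1\<close>; indices beyond \<open>Suc m\<close> are treated like \<open>Suc m\<close>\<close>
  define B where "B i j = (if i < m then if j < m then Y $$ (i, j) else if j = m then b $ i else a $ i
      else if i = m then if j < m then - b $ j else if j = m then 0 else 1
      else if j < m then - a $ j else if j = m then - 1 else 0)" for i j
  have skewB: "B i j = - B j i" for i j
    using skewY[of i j] by (auto simp: B_def)
  interpret alternating_form B
    by unfold_locales (use diag in \<open>simp add: B_def\<close>, rule skewB)
  let ?xs = "[0..<m]"
  have pf_cong: "pf xs = pf_list (\<lambda>i j. Y $$ (i, j)) xs" if "set xs \<subseteq> {..<m}" for xs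
    using that by (intro pf_list_cong) (auto simp: B_def)
  have pfY: "pf ?xs = pfaffian Y"
    using Y by (simp add: pf_cong pfaffian_eq_pf_list atLeast0LessThan del: pf_list.simps)
  have pf_del: "pf (del_two i j ?xs) = pfaffian (delete_two Y i j)" if "i < m" "j < m" "i \<noteq> j" for i j
  proof -
    have "set (del_two i j ?xs) \<subseteq> {..<m}"
      unfolding del_two_upt[OF that] using set_nths_subset[of ?xs "- {i, j}"] by auto
    then show ?thesis by (simp add: pf_cong pfaffian_delete_two[OF Y that])
  qed
  have "det (Y + M) = minor B (m # ?xs) (Suc m # ?xs)"
    unfolding assms(7) det_add_rank1[OF Y] minor_def
    by (intro arg_cong[where f = det] eq_matI) (use Y in \<open>auto simp: B_def nth_Cons split: nat.splits\<close>)
  also have "\<dots> = pfaffian Y * pf (m # Suc m # ?xs)"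
    using assms(1) by (simp add: bordered_minor pfY del: pf_list.simps)
  also have "pf (m # Suc m # ?xs) = pfaffian Y + (\<Sum>(i, j)\<in>{(i, j). i < j \<and> j < m}.
      (-1) ^ (i + j + 1) * (a $ i * b $ j - a $ j * b $ i) * pfaffian (delete_two Y i j))"
  proof -
    let ?h = "\<lambda>k l. (-1) ^ (k + delete_index k l) * B m (?xs ! k) * B (Suc m) (?xs ! l)
        * pf (del_two k l ?xs)"
    have h: "?h i j + ?h j i
        = - ((-1) ^ (i + j + 1) * (a $ i * b $ j - a $ j * b $ i) * pfaffian (delete_two Y i j))"
      if ij: "i < j" "j < m" for i j
    proof -
      have "(-1 :: 'a) ^ (i + delete_index i j) = - ((-1) ^ (i + j))"
        using ij by (subst delete_index_sign_antisym) (auto simp: delete_index_def add.commute)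
      moreover have "delete_index j i = i" using ij by (simp add: delete_index_def)
      moreover have "pf (del_two i j ?xs) = pfaffian (delete_two Y i j)"
        "pf (del_two j i ?xs) = pfaffian (delete_two Y i j)"
        using ij pf_del[of i j] del_two_commute[of j ?xs i] by simp_all
      ultimately show ?thesis
        using ij by (simp add: B_def algebra_simps)
    qed
    have "pf (m # Suc m # ?xs) = pfaffian Y - (\<Sum>(i, j)\<in>{(i, j). i < j \<and> j < m}. ?h i j + ?h j i)"
      unfolding pf_list_expand_two sum_offdiag pfY by (simp add: B_def)
    also have "(\<Sum>(i, j)\<in>{(i, j). i < j \<and> j < m}. ?h i j + ?h j i)
      = (\<Sum>(i, j)\<in>{(i, j). i < j \<and> j < m}.
          - ((-1) ^ (i + j + 1) * (a $ i * b $ j - a $ j * b $ i) * pfaffian (delete_two Y i j)))"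
      by (rule sum.cong[OF refl]) (use h in auto)
    finally show ?thesis by (simp add: sum_negf case_prod_unfold)
  qed
  finally show ?thesis .
qed

end
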